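(* Assume the Diagonal Conjecture (DC) holds: for every $r \ge 2$, all integers $3 \le s \le t$ and all integers $k_3,\dots,k_r \ge 2$, we have $R(s,t,k_3,\dots,k_r) \ge R(s-1,t+1,k_3,\dots,k_r)$. Then for every integer $k \ge 3$, $$\lim_{r\to\infty} \frac{R_r(k)^{1/r}}{R_r(k-1)^{1/r}} > 1.$$
   Context: $R(k_1,\dots,k_r)$ denotes the multicolor Ramsey number: the least $n$ such that every coloring of the edges of $K_n$ with $r$ colors contains, for some $i$, a complete subgraph $K_{k_i}$ all of whose edges have color $i$; it is symmetric in its arguments. $R_r(k)=R(k,\dots,k)$ with $r$ arguments equal to $k$; note $R_r(2)=2$. *)

theory Defs
  imports Complex_Main "HOL-Library.Extended_Real"
begin

definition edge_colouring :: "nat \<Rightarrow> nat \<Rightarrow> (nat set \<Rightarrow> nat) \<Rightarrow> bool" where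
  "edge_colouring n r c \<longleftrightarrow> (\<forall>e. e \<subseteq> {..<n} \<and> card e = 2 \<longrightarrow> c e < r)"

definition mono_clique :: "nat \<Rightarrow> (nat set \<Rightarrow> nat) \<Rightarrow> nat \<Rightarrow> nat \<Rightarrow> bool" where
  "mono_clique n c i k \<longleftrightarrow>
     (\<exists>S. S \<subseteq> {..<n} \<and> card S = k \<and> (\<forall>e. e \<subseteq> S \<and> card e = 2 \<longrightarrow> c e = i))"

definition ramsey :: "nat list \<Rightarrow> nat" where
  "ramsey ks = (LEAST n. \<forall>c. edge_colouring n (length ks) c \<longrightarrow>
                    (\<exists>i < length ks. mono_clique n c i (ks ! i)))"

definition ramsey_diag :: "nat \<Rightarrow> nat \<Rightarrow> nat" where
  "ramsey_diag r k = ramsey (replicate r k)"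

definition diagonal_conjecture :: bool where
  "diagonal_conjecture \<longleftrightarrow>
     (\<forall>r s t ks. 2 \<le> r \<and> 3 \<le> s \<and> s \<le> t \<and> length ks = r - 2 \<and> (\<forall>k\<in>set ks. 2 \<le> k) \<longrightarrow>
        ramsey ((s - 1) # (t + 1) # ks) \<le> ramsey (s # t # ks))"

end

theory Submission
  imports Defs "HOL-Library.Ramsey" "HOL-Combinatorics.Permutations"
begin

text \<open>Under the conjecture, \<open>R\<^sub>r(k) - 1 \<ge> (R\<^sub>r(k-1) - 1) (R\<^sub>q(k) - 1)\<close> with
  \<open>q = r div (k - 2)\<^sup>2\<close>.
  By Fekete's lemma \<open>R\<^sub>r(k)\<^bsup>1/r\<^esup>\<close> has a limit, finite or infinite. If it is finite, then the numerator and the denominator converge separately and the inequality separates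
  their limits. If it is infinite, the factor \<open>R\<^sub>q(k) - 1\<close> alone makes the ratio diverge, whatever
  the denominator does.\<close>

section \<open>Colourings avoiding prescribed cliques\<close>

text \<open>The negation of the property that \<open>ramsey\<close> minimises. Lower bounds on
  Ramsey numbers become constructions of colourings, and inequalities between Ramsey numbers become
  implications between avoidabilities.\<close>

definition avoidable :: "nat list \<Rightarrow> nat \<Rightarrow> bool" where
  "avoidable ks n \<longleftrightarrow>
     (\<exists>c. edge_colouring n (length ks) c \<and> (\<forall>i<length ks. \<not> mono_clique n c i (ks ! i)))"

lemma mono_cliqueI:
  assumes "S \<subseteq> {..<n}" "k \<le> card S"
    and mono: "\<And>u v. u \<in> S \<Longrightarrow> v \<in> S \<Longrightarrow> u \<noteq> v \<Longrightarrow> c {u, v} = i"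
  shows "mono_clique n c i k"
proof -
  obtain T where T: "T \<subseteq> S" "card T = k"
    using assms(2) by (meson obtain_subset_with_card_n)
  have "c e = i" if e: "e \<subseteq> T" "card e = 2" for e
  proof -
    obtain u v where "e = {u, v}" "u \<noteq> v"
      using e(2) card_2_iff by metis
    then show ?thesis
      using mono e(1) T(1) by auto
  qed
  then show ?thesis
    unfolding mono_clique_def using T assms(1) by blast
qed

lemma mono_cliqueE:
  assumes "mono_clique n c i k"
  obtains S where "S \<subseteq> {..<n}" "card S = k"
    "\<And>u v. u \<in> S \<Longrightarrow> v \<in> S \<Longrightarrow> u \<noteq> v \<Longrightarrow> c {u, v} = i"
proof -
  obtain S where S: "S \<subseteq> {..<n}" "card S = k"
      "\<And>e. e \<subseteq> S \<Longrightarrow> card e = 2 \<Longrightarrow> c e = i"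
    using assms unfolding mono_clique_def by blast
  show ?thesis
    by (rule that[of S]) (use S in auto)
qed

lemma mono_clique_mono:
  assumes "mono_clique m c i k" "m \<le> n" "j \<le> k"
  shows "mono_clique n c i j"
proof -
  obtain S where S: "S \<subseteq> {..<m}" "card S = k"
      "\<And>u v. u \<in> S \<Longrightarrow> v \<in> S \<Longrightarrow> u \<noteq> v \<Longrightarrow> c {u, v} = i"
    using assms(1) by (rule mono_cliqueE) blast
  show ?thesis
    by (rule mono_cliqueI[of S]) (use S assms(2,3) in auto)
qed

lemma avoidable_antimono:
  assumes "avoidable ks n" "m \<le> n"
  shows "avoidable ks m"
proof -
  obtain c where "edge_colouring n (length ks) c"
      "\<forall>i<length ks. \<not> mono_clique n c i (ks ! i)"
    using assms(1) unfolding avoidable_def by blast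
  moreover from this have "edge_colouring m (length ks) c"
    using assms(2) unfolding edge_colouring_def
    by (meson lessThan_subset_iff subset_trans)
  ultimately show ?thesis
    unfolding avoidable_def using mono_clique_mono[OF _ assms(2) order_refl] by blast
qed

text \<open>The finite Ramsey theorem, without which the \<open>LEAST\<close> in
  \<open>ramsey\<close> would have no usable value.\<close>

lemma not_avoidable_large: "\<exists>n. \<not> avoidable ks n"
proof -
  obtain N :: nat where N: "partn_lst {..<N} ks 2"
    using ramsey_full by blast
  have "\<exists>i<length ks. mono_clique N c i (ks ! i)" if c: "edge_colouring N (length ks) c" for c
  proof -
    have "c \<in> nsets {..<N} 2 \<rightarrow> {..<length ks}"
      using c by (auto simp: edge_colouring_def nsets_def)
    then obtain i where i: "i < length ks" "monochromatic {..<N} (ks ! i) 2 c i"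
      using N unfolding partn_lst_def by blast
    then obtain H where H: "H \<in> nsets {..<N} (ks ! i)" "c ` nsets H 2 \<subseteq> {i}"
      unfolding monochromatic_def by blast
    have "mono_clique N c i (ks ! i)"
      by (rule mono_cliqueI[of H]) (use H in \<open>auto simp: nsets_def image_subset_iff\<close>)
    with i(1) show ?thesis by blast
  qed
  then show ?thesis
    unfolding avoidable_def by blast
qed

text \<open>Restricting a colouring creates no cliques, so the avoidable sizes form an initial
  segment; Ramsey's theorem makes it finite, and \<open>ramsey ks\<close> is the first size beyond
  it.\<close>

lemma less_ramsey_iff: "n < ramsey ks \<longleftrightarrow> avoidable ks n"
proof -
  have eq: "ramsey ks = (LEAST n. \<not> avoidable ks n)"
    unfolding ramsey_def avoidable_def by (rule arg_cong[where f = Least]) auto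
  have "\<not> avoidable ks (ramsey ks)"
    unfolding eq by (rule LeastI_ex[OF not_avoidable_large])
  then show ?thesis
    using avoidable_antimono not_less_Least[of n "\<lambda>n. \<not> avoidable ks n"]
    by (metis eq linorder_not_le)
qed

lemma ramsey_leI:
  assumes "\<And>n. avoidable ks n \<Longrightarrow> avoidable ls n"
  shows "ramsey ks \<le> ramsey ls"
proof (rule ccontr)
  assume "\<not> ramsey ks \<le> ramsey ls"
  then have "avoidable ks (ramsey ls)"
    by (simp add: less_ramsey_iff[symmetric])
  then have "avoidable ls (ramsey ls)"
    by (rule assms)
  then show False
    by (simp add: less_ramsey_iff[symmetric])
qed

lemma avoidable_le:
  assumes "avoidable ks n" "list_all2 (\<le>) ks ls"
  shows "avoidable ls n"
proof -
  obtain c where c: "edge_colouring n (length ks) c"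
      "\<forall>i<length ks. \<not> mono_clique n c i (ks ! i)"
    using assms(1) unfolding avoidable_def by blast
  have "\<forall>i<length ks. \<not> mono_clique n c i (ls ! i)"
    using c(2) assms(2) mono_clique_mono[OF _ order_refl] by (metis list_all2_nthD)
  then show ?thesis
    unfolding avoidable_def using c(1) list_all2_lengthD[OF assms(2)] by (intro exI[of _ c]) simp
qed

text \<open>The same colouring works, since forbidding a clique of size 2 only says that the added
  colour never occurs. This padding gives colourings with different palettes lists of equal length,
  as the product below requires.\<close>

lemma avoidable_append_replicate_2:
  assumes "avoidable ks n"
  shows "avoidable (ks @ replicate s 2) n"
proof -
  obtain c where c: "edge_colouring n (length ks) c"
      "\<forall>i<length ks. \<not> mono_clique n c i (ks ! i)"
    using assms unfolding avoidable_def by blast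
  have "\<not> mono_clique n c i ((ks @ replicate s 2) ! i)" if i: "i < length ks + s" for i
  proof (cases "i < length ks")
    case True
    then show ?thesis using c by (simp add: nth_append)
  next
    case False
    have "\<not> mono_clique n c i 2"
      using c(1) False unfolding mono_clique_def edge_colouring_def by blast
    then show ?thesis using False i by (simp add: nth_append)
  qed
  moreover have "edge_colouring n (length ks + s) c"
    using c(1) unfolding edge_colouring_def by (meson trans_less_add1)
  ultimately show ?thesis
    unfolding avoidable_def by (intro exI[of _ c]) simp
qed

lemma avoidable_permute:
  assumes "avoidable ks n" "mset ks = mset ls"
  shows "avoidable ls n"
proof -
  obtain p where p: "p permutes {..<length ls}" "permute_list p ls = ks"
    using mset_eq_permutation[OF assms(2)] .
  have len: "length ks = length ls"
    using assms(2) by (metis size_mset)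
  obtain c where c: "edge_colouring n (length ks) c"
      "\<forall>i<length ks. \<not> mono_clique n c i (ks ! i)"
    using assms(1) unfolding avoidable_def by blast
  \<comment> \<open>Here \<open>ks ! j = ls ! p j\<close>, so renaming colour \<open>j\<close> to
    \<open>p j\<close> carries each forbidden size along.\<close>
  have "\<not> mono_clique n (\<lambda>e. p (c e)) i (ls ! i)" if i: "i < length ls" for i
  proof -
    obtain j where j: "j < length ls" "p j = i"
      using i p(1) by (metis imageE lessThan_iff permutes_image)
    have "mono_clique n c j (ls ! i)" if "mono_clique n (\<lambda>e. p (c e)) i (ls ! i)"
      using that unfolding mono_clique_def j(2)[symmetric]
      by (metis p(1) permutes_inj injD)
    moreover have "ks ! j = ls ! i"
      using permute_list_nth[OF p(1) j(1)] p(2) j(2) by simp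
    ultimately show ?thesis
      using c(2) j(1) len by metis
  qed
  moreover have "edge_colouring n (length ls) (\<lambda>e. p (c e))"
    using c(1) p(1) len unfolding edge_colouring_def
    by (metis lessThan_iff permutes_in_image)
  ultimately show ?thesis
    unfolding avoidable_def by (intro exI[of _ "\<lambda>e. p (c e)"]) simp
qed

text \<open>The conjecture acts on the first two arguments only; this symmetry brings any others to
  the front.\<close>

lemma ramsey_cong_mset: "mset ks = mset ls \<Longrightarrow> ramsey ks = ramsey ls"
  using avoidable_permute[of ks _ ls] avoidable_permute[of ls _ ks]
  by (simp add: antisym ramsey_leI)

text \<open>The lexicographic product of two colourings that use the same colours: the vertex
  \<open>v\<close> of the product stands for the pair \<open>(v div m, v mod m)\<close>.\<close>

lemma avoidable_lex_product:
  assumes ks: "avoidable ks n" and ls: "avoidable ls m" and len: "length ks = length ls"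
  shows "avoidable (map2 (\<lambda>k l. (k - 1) * (l - 1) + 1) ks ls) (n * m)"
proof -
  obtain c where c: "edge_colouring n (length ls) c"
      "\<And>i. i < length ls \<Longrightarrow> \<not> mono_clique n c i (ks ! i)"
    using ks unfolding avoidable_def len by blast
  obtain d where d: "edge_colouring m (length ls) d"
      "\<And>i. i < length ls \<Longrightarrow> \<not> mono_clique m d i (ls ! i)"
    using ls unfolding avoidable_def by blast
  define P where "P = (\<lambda>v. v div m)"
  define Q where "Q = (\<lambda>v. v mod m)"
  \<comment> \<open>An edge between different blocks is coloured by \<open>c\<close>, an edge inside
    a block by \<open>d\<close>; the test asks whether the endpoints lie in different
    blocks.\<close>
  define f where "f = (\<lambda>e. if card (P ` e) = 2 then c (P ` e) else d (Q ` e))"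
  have P: "P v < n" and Q: "Q v < m" if "v < n * m" for v
    using that by (auto simp: P_def Q_def less_mult_imp_div_less intro!: mod_less_divisor gr0I)
  have PQ: "u = v" if "P u = P v" "Q u = Q v" for u v
    using that unfolding P_def Q_def by (metis div_mult_mod_eq)
  have f1: "f {u, v} = c {P u, P v}" if "P u \<noteq> P v" for u v
    using that by (simp add: f_def)
  have f2: "f {u, v} = d {Q u, Q v}" if "P u = P v" for u v
    using that by (simp add: f_def)
  have "edge_colouring (n * m) (length ls) f"
    unfolding edge_colouring_def
  proof safe
    fix e :: "nat set" assume e: "e \<subseteq> {..<n * m}" "card e = 2"
    then obtain u v where uv: "e = {u, v}" "u \<noteq> v"
      by (meson card_2_iff)
    then have lt: "u < n * m" "v < n * m" using e by auto
    show "f e < length ls"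
    proof (cases "P u = P v")
      case True
      then have "Q u \<noteq> Q v" using PQ uv by blast
      then have "d {Q u, Q v} < length ls"
        using d(1) Q[OF lt(1)] Q[OF lt(2)] unfolding edge_colouring_def by simp
      then show ?thesis using f2[OF True] uv by simp
    next
      case False
      then have "c {P u, P v} < length ls"
        using c(1) P[OF lt(1)] P[OF lt(2)] unfolding edge_colouring_def by simp
      then show ?thesis using f1[OF False] uv by simp
    qed
  qed
  moreover have "\<not> mono_clique (n * m) f i ((ks ! i - 1) * (ls ! i - 1) + 1)"
    if i: "i < length ls" for i
  proof
    assume "mono_clique (n * m) f i ((ks ! i - 1) * (ls ! i - 1) + 1)"
    then obtain S where S: "S \<subseteq> {..<n * m}" "card S = (ks ! i - 1) * (ls ! i - 1) + 1"
      "\<And>u v. u \<in> S \<Longrightarrow> v \<in> S \<Longrightarrow> u \<noteq> v \<Longrightarrow> f {u, v} = i"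
      by (rule mono_cliqueE) blast
    have fin: "finite S" using S(1) finite_subset by blast
    \<comment> \<open>The blocks met by \<open>S\<close> form a clique of colour \<open>i\<close>
      under \<open>c\<close>.\<close>
    have "card (P ` S) < ks ! i"
    proof (rule ccontr)
      assume *: "\<not> card (P ` S) < ks ! i"
      have "mono_clique n c i (ks ! i)"
      proof (rule mono_cliqueI[of "P ` S"])
        show "P ` S \<subseteq> {..<n}" using S(1) P by auto
        show "ks ! i \<le> card (P ` S)" using * by simp
        show "c {a, b} = i" if "a \<in> P ` S" "b \<in> P ` S" "a \<noteq> b" for a b
          using that S(3) f1 by (metis imageE)
      qed
      with c(2) i show False by blast
    qed
    then have 1: "card (P ` S) \<le> ks ! i - 1" by simp
    \<comment> \<open>Inside one block the second coordinates are distinct and form a clique of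
      colour \<open>i\<close> under \<open>d\<close>. Counting \<open>S\<close> block by block then
      contradicts its size.\<close>
    have 2: "card (S \<inter> P -` {a}) \<le> ls ! i - 1" for a
    proof -
      let ?F = "S \<inter> P -` {a}"
      have inj: "inj_on Q ?F" using PQ by (auto simp: inj_on_def)
      have "card (Q ` ?F) < ls ! i"
      proof (rule ccontr)
        assume *: "\<not> card (Q ` ?F) < ls ! i"
        have "mono_clique m d i (ls ! i)"
        proof (rule mono_cliqueI[of "Q ` ?F"])
          show "Q ` ?F \<subseteq> {..<m}" using S(1) Q by auto
          show "ls ! i \<le> card (Q ` ?F)" using * by simp
          show "d {a, b} = i" if ab: "a \<in> Q ` ?F" "b \<in> Q ` ?F" "a \<noteq> b" for a b
          proof -
            obtain u v where uv: "u \<in> ?F" "v \<in> ?F" "a = Q u" "b = Q v" using ab by blast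
            then have "P u = P v" "u \<noteq> v" using ab by auto
            then show ?thesis using f2 S(3) uv by (metis IntD1)
          qed
        qed
        with d(2) i show False by blast
      qed
      then show ?thesis using card_image[OF inj] by simp
    qed
    have "S = (\<Union>a\<in>P ` S. S \<inter> P -` {a})" by auto
    then have "card S \<le> (\<Sum>a\<in>P ` S. card (S \<inter> P -` {a}))"
      using card_UN_le[of "P ` S" "\<lambda>a. S \<inter> P -` {a}"] fin by simp
    also have "\<dots> \<le> card (P ` S) * (ls ! i - 1)"
      using sum_bounded_above[of "P ` S" "\<lambda>a. card (S \<inter> P -` {a})", OF 2] by simp
    also have "\<dots> \<le> (ks ! i - 1) * (ls ! i - 1)"
      using 1 by simp
    finally show False using S(2) by simp
  qed
  ultimately show ?thesis
    unfolding avoidable_def using len by (intro exI[of _ f]) simp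
qed

section \<open>Elementary lower bounds for diagonal Ramsey numbers\<close>

lemma avoidable_1:
  assumes "\<forall>k\<in>set ks. 2 \<le> k"
  shows "avoidable ks 1"
proof -
  have "\<not> mono_clique 1 c i (ks ! i)" if "i < length ks" for c :: "nat set \<Rightarrow> nat" and i
  proof
    assume "mono_clique 1 c i (ks ! i)"
    then obtain S where "S \<subseteq> {..<1::nat}" "card S = ks ! i"
      by (rule mono_cliqueE) blast
    then have "ks ! i \<le> 1"
      using card_mono[of "{..<1::nat}" S] by simp
    moreover have "2 \<le> ks ! i"
      using assms that by simp
    ultimately show False by simp
  qed
  moreover have "edge_colouring 1 (length ks) c" for c
  proof -
    have "card e \<noteq> 2" if "e \<subseteq> {..<1::nat}" for e
      using card_mono[OF _ that] by simp
    then show ?thesis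
      unfolding edge_colouring_def by blast
  qed
  ultimately show ?thesis unfolding avoidable_def by blast
qed

text \<open>The bound keeps \<open>ramsey_diag r k - 1\<close> positive and its logarithm
  nonnegative. The case \<open>r = 0\<close> is included, because
  \<open>r div (k - 2)\<^sup>2\<close> can be \<open>0\<close> later.\<close>

lemma ramsey_diag_ge_2: "2 \<le> k \<Longrightarrow> 2 \<le> ramsey_diag r k"
  using avoidable_1[of "replicate r k"] less_ramsey_iff[of 1 "replicate r k"]
  by (simp add: ramsey_diag_def)

lemma avoidable_pred_ramsey_diag:
  "2 \<le> k \<Longrightarrow> avoidable (replicate r k) (ramsey_diag r k - 1)"
  using ramsey_diag_ge_2[of k r] less_ramsey_iff[of "ramsey_diag r k - 1" "replicate r k"]
  by (simp add: ramsey_diag_def)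

lemma ramsey_diag_1: "k \<le> ramsey_diag 1 k"
proof (cases k)
  case (Suc j)
  have "\<not> mono_clique j (\<lambda>_. 0) 0 (Suc j)"
  proof
    assume "mono_clique j (\<lambda>_. 0) 0 (Suc j)"
    then obtain S where "S \<subseteq> {..<j}" "card S = Suc j"
      by (rule mono_cliqueE) blast
    then show False
      using card_mono[of "{..<j}" S] by simp
  qed
  then have "avoidable (replicate 1 k) j"
    unfolding avoidable_def edge_colouring_def using Suc by (intro exI[of _ "\<lambda>_. 0"]) simp
  then show ?thesis
    unfolding ramsey_diag_def less_ramsey_iff[symmetric] using Suc by simp
qed simp

text \<open>In the product of two colourings with disjoint palettes, each colour occurs in only one
  factor; it combines \<open>k\<close> with \<open>2\<close>, and
  \<open>(k - 1) * (2 - 1) + 1 = k\<close>.\<close>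

lemma ramsey_diag_supermult:
  assumes "2 \<le> k"
  shows "(ramsey_diag r k - 1) * (ramsey_diag s k - 1) \<le> ramsey_diag (r + s) k - 1"
proof -
  let ?m = "ramsey_diag r k - 1" and ?n = "ramsey_diag s k - 1"
  have "avoidable (replicate s k @ replicate r 2) ?n"
    by (intro avoidable_append_replicate_2 avoidable_pred_ramsey_diag assms)
  then have "avoidable (replicate r 2 @ replicate s k) ?n"
    by (rule avoidable_permute) simp
  moreover have "avoidable (replicate r k @ replicate s 2) ?m"
    by (intro avoidable_append_replicate_2 avoidable_pred_ramsey_diag assms)
  ultimately have "avoidable (map2 (\<lambda>k l. (k - 1) * (l - 1) + 1)
      (replicate r k @ replicate s 2) (replicate r 2 @ replicate s k)) (?m * ?n)"
    by (intro avoidable_lex_product) auto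
  also have "map2 (\<lambda>k l. (k - 1) * (l - 1) + 1)
      (replicate r k @ replicate s 2) (replicate r 2 @ replicate s k) = replicate (r + s) k"
    using assms by (simp add: zip_replicate1 replicate_add numeral_2_eq_2)
  finally show ?thesis
    unfolding less_ramsey_iff[symmetric] ramsey_diag_def[symmetric] by simp
qed

section \<open>Consequences of the Diagonal Conjecture\<close>

lemma diagonal_conjecture_step:
  assumes "diagonal_conjecture" "3 \<le> s" "s \<le> t" "\<forall>k\<in>set ks. 2 \<le> k"
  shows "ramsey ((s - 1) # (t + 1) # ks) \<le> ramsey (s # t # ks)"
  using assms(1)[unfolded diagonal_conjecture_def, rule_format, of "length ks + 2" s t ks] assms
  by auto

text \<open>Each use of the conjecture moves one unit from an argument \<open>k\<close> to the
  distinguished argument. That argument only grows, so it stays at least \<open>k\<close> as the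
  conjecture demands.\<close>

lemma ramsey_concentrate:
  assumes dc: "diagonal_conjecture" and k: "3 \<le> k"
    and "k \<le> t" "\<forall>x\<in>set ks. 2 \<le> x"
  shows "ramsey ((t + j) # replicate j (k - 1) @ ks) \<le> ramsey (t # replicate j k @ ks)"
  using assms(3,4)
proof (induction j arbitrary: t ks)
  case (Suc j)
  have "ramsey ((t + Suc j) # replicate (Suc j) (k - 1) @ ks)
      = ramsey ((t + 1 + j) # replicate j (k - 1) @ ((k - 1) # ks))"
    by (rule ramsey_cong_mset) simp
  \<comment> \<open>The argument already lowered to \<open>k - 1\<close> is parked in the tail,
    which is why the induction generalises over \<open>t\<close> and \<open>ks\<close>.\<close>
  also have "\<dots> \<le> ramsey ((t + 1) # replicate j k @ ((k - 1) # ks))"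
    by (rule Suc.IH) (use Suc.prems k in auto)
  also have "\<dots> = ramsey ((k - 1) # (t + 1) # replicate j k @ ks)"
    by (rule ramsey_cong_mset) simp
  also have "\<dots> \<le> ramsey (k # t # replicate j k @ ks)"
    by (rule diagonal_conjecture_step) (use dc k Suc.prems in auto)
  also have "\<dots> = ramsey (t # replicate (Suc j) k @ ks)"
    by (rule ramsey_cong_mset) simp
  finally show ?case .
qed simp

lemma ramsey_concentrate_blocks:
  assumes dc: "diagonal_conjecture" and k: "3 \<le> k" and "\<forall>x\<in>set ks. 2 \<le> x"
  shows "ramsey (replicate q (k + j) @ replicate (q * j) (k - 1) @ ks)
           \<le> ramsey (replicate (q * Suc j) k @ ks)"
  using assms(3)
proof (induction q arbitrary: ks)
  case (Suc q)
  have "ramsey (replicate (Suc q) (k + j) @ replicate (Suc q * j) (k - 1) @ ks)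
      = ramsey (replicate q (k + j) @ replicate (q * j) (k - 1)
                 @ ((k + j) # replicate j (k - 1) @ ks))"
    by (rule ramsey_cong_mset) (simp add: replicate_add)
  also have "\<dots> \<le> ramsey (replicate (q * Suc j) k @ ((k + j) # replicate j (k - 1) @ ks))"
    by (rule Suc.IH) (use Suc.prems k in auto)
  also have "\<dots> = ramsey ((k + j) # replicate j (k - 1) @ (replicate (q * Suc j) k @ ks))"
    by (rule ramsey_cong_mset) simp
  also have "\<dots> \<le> ramsey (k # replicate j k @ (replicate (q * Suc j) k @ ks))"
    by (rule ramsey_concentrate) (use dc k Suc.prems in auto)
  also have "\<dots> = ramsey (replicate (Suc q * Suc j) k @ ks)"
    by (rule ramsey_cong_mset) (simp add: replicate_add)
  finally show ?case .
qed simp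

text \<open>Substituting a \<open>q\<close>-colouring without \<open>K\<^sub>k\<close> into an \<open>r\<close>-colouring without \<open>K\<^bsub>k-1\<^esub>\<close>
  raises the forbidden clique size of \<open>q\<close> colours from \<open>k - 1\<close> to
  \<open>(k - 2) * (k - 1) + 1 = (k - 1) + (k - 2)\<^sup>2\<close>, and the conjecture pays for each such colour
  by lowering \<open>(k - 2)\<^sup>2\<close> arguments from \<open>k\<close> to \<open>k - 1\<close>.\<close>

lemma ramsey_diag_pred_mult_le:
  assumes dc: "diagonal_conjecture" and k: "3 \<le> k"
  shows "(ramsey_diag r (k - 1) - 1) * (ramsey_diag (r div (k - 2)\<^sup>2) k - 1)
           \<le> ramsey_diag r k - 1"
proof -
  \<comment> \<open>Writing \<open>k = a + 3\<close> turns truncated subtraction into polynomial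
    arithmetic.\<close>
  define a where "a = k - 3"
  have ka: "k = a + 3" using k by (simp add: a_def)
  \<comment> \<open>A block has \<open>Suc j\<close> arguments equal to \<open>k\<close>: one rises
    to \<open>k + j\<close>, the other \<open>j\<close> fall to \<open>k - 1\<close>.\<close>
  define j where "j = (k - 2)\<^sup>2 - 1"
  have j: "Suc j = (k - 2)\<^sup>2" unfolding j_def ka by simp
  have kj: "(k - 2) * (k - 1) + 1 = k + j"
    using j unfolding ka by (simp add: power2_eq_square)
  define q where "q = r div Suc j"
  define p where "p = r mod Suc j"
  have r: "r = q * Suc j + p" unfolding q_def p_def by (rule div_mult_mod_eq[symmetric])
  have rq: "r = q + (q * j + p)" using r by simp
  let ?m = "ramsey_diag r (k - 1) - 1" and ?n = "ramsey_diag q k - 1"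
  have "avoidable (replicate r (k - 1)) ?m"
    by (rule avoidable_pred_ramsey_diag) (use k in simp)
  \<comment> \<open>In the padded colours the product size is
    \<open>(k - 2) * 1 + 1 = k - 1\<close>, so nothing is raised there.\<close>
  moreover have "avoidable (replicate q k @ replicate (q * j + p) 2) ?n"
    by (intro avoidable_append_replicate_2 avoidable_pred_ramsey_diag) (use k in simp)
  ultimately have "avoidable (map2 (\<lambda>k l. (k - 1) * (l - 1) + 1) (replicate r (k - 1))
      (replicate q k @ replicate (q * j + p) 2)) (?m * ?n)"
    by (rule avoidable_lex_product) (use rq in simp)
  also have "map2 (\<lambda>k l. (k - 1) * (l - 1) + 1) (replicate r (k - 1))
      (replicate q k @ replicate (q * j + p) 2)
     = replicate q ((k - 2) * (k - 1) + 1) @ replicate (q * j + p) (k - 1)"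
    unfolding rq replicate_add[of q "q * j + p"] ka
    by (simp add: zip_replicate1 numeral_2_eq_2)
  also have "\<dots> = replicate q (k + j) @ replicate (q * j) (k - 1) @ replicate p (k - 1)"
    unfolding kj by (simp add: replicate_add)
  finally have "?m * ?n < ramsey (replicate q (k + j) @ replicate (q * j) (k - 1) @ replicate p (k - 1))"
    unfolding less_ramsey_iff .
  also have "\<dots> \<le> ramsey (replicate (q * Suc j) k @ replicate p (k - 1))"
    by (rule ramsey_concentrate_blocks) (use dc k in auto)
  \<comment> \<open>The \<open>p\<close> colours left over by the division fill no block; they are
    raised to \<open>k\<close> by monotonicity.\<close>
  also have "\<dots> \<le> ramsey (replicate (q * Suc j) k @ replicate p k)"
    by (intro ramsey_leI, erule avoidable_le)
      (auto simp: list_all2_conv_all_nth nth_append)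
  also have "replicate (q * Suc j) k @ replicate p k = replicate r k"
    unfolding r by (rule replicate_add[symmetric])
  finally show ?thesis
    unfolding ramsey_diag_def[symmetric] q_def j by simp
qed

section \<open>Superadditive sequences\<close>

lemma superadditive_mult_le:
  fixes u :: "nat \<Rightarrow> real"
  assumes "\<And>m n. u m + u n \<le> u (m + n)" and "\<And>n. 0 \<le> u n"
  shows "real q * u m \<le> u (q * m)"
proof (induction q)
  case (Suc q)
  then show ?case
    using assms(1)[of m "q * m"] by (simp add: algebra_simps)
qed (simp add: assms(2))

text \<open>Split \<open>n\<close> into \<open>n div m\<close> pieces of length \<open>m\<close> and
  a remainder, whose value is dropped; the loss is at most \<open>u m / n\<close>. No upper bound on
  the quotients is assumed, so this also serves the unbounded case.\<close>

lemma superadditive_eventually_gt: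
  fixes u :: "nat \<Rightarrow> real"
  assumes sup: "\<And>m n. u m + u n \<le> u (m + n)" and nn: "\<And>n. 0 \<le> u n"
    and m: "0 < m" and l: "l < u m / real m"
  shows "eventually (\<lambda>n. l < u n / real n) sequentially"
proof -
  have "(\<lambda>n. u m / real m - u m / real n) \<longlonglongrightarrow> u m / real m - 0"
    by (intro tendsto_diff tendsto_const lim_const_over_n)
  then have "eventually (\<lambda>n. l < u m / real m - u m / real n) sequentially"
    using l by (intro order_tendstoD(1)) auto
  then show ?thesis
    using eventually_gt_at_top[of "0::nat"]
  proof eventually_elim
    case (elim n)
    have "real n < real (Suc (n div m) * m)"
      using m by (metis dividend_less_div_times mult.commute mult_Suc of_nat_less_iff)
    then have "(real n / real m - 1) \<le> real (n div m)"
      using m by (simp add: field_simps)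
    then have "(real n / real m - 1) * u m \<le> real (n div m) * u m"
      by (rule mult_right_mono) (rule nn)
    also have "\<dots> \<le> u (n div m * m)"
      by (rule superadditive_mult_le[of u, OF sup nn])
    also have "\<dots> \<le> u (n div m * m + n mod m)"
      using sup[of "n div m * m" "n mod m"] nn[of "n mod m"] by linarith
    finally have "(real n / real m - 1) * u m / real n \<le> u n / real n"
      by (simp add: divide_right_mono)
    moreover have "(real n / real m - 1) * u m / real n = u m / real m - u m / real n"
      using elim m by (simp add: field_simps)
    ultimately show ?case using elim by linarith
  qed
qed

lemma fekete:
  fixes u :: "nat \<Rightarrow> real"
  assumes sup: "\<And>m n. u m + u n \<le> u (m + n)" and nn: "\<And>n. 0 \<le> u n"
    and bd: "\<And>n. 0 < n \<Longrightarrow> u n / real n \<le> C"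
  obtains l where "(\<lambda>n. u n / real n) \<longlonglongrightarrow> l" "\<And>n. 0 < n \<Longrightarrow> u n / real n \<le> l"
proof
  let ?l = "SUP n\<in>{0<..}. u n / real n"
  have bdd: "bdd_above ((\<lambda>n. u n / real n) ` {0<..})"
    using bd by (intro bdd_aboveI2[of _ _ C]) auto
  show le: "u n / real n \<le> ?l" if "0 < n" for n
    using that by (intro cSUP_upper bdd) auto
  show "(\<lambda>n. u n / real n) \<longlonglongrightarrow> ?l"
  proof (rule order_tendstoI)
    fix a assume "a < ?l"
    then obtain m where "0 < m" "a < u m / real m"
      using less_cSUP_iff[OF _ bdd] by auto
    then show "eventually (\<lambda>n. a < u n / real n) sequentially"
      by (rule superadditive_eventually_gt[of u, OF sup nn])
  next
    fix a assume less: "?l < a"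
    show "eventually (\<lambda>n. u n / real n < a) sequentially"
      by (rule eventually_mono[OF eventually_gt_at_top[of 0]]) (rule le_less_trans[OF le less])
  qed
qed

text \<open>If \<open>x n / n\<close> is bounded, \<open>x n / n\<close> and \<open>y n / n\<close> both converge. Otherwise the recursive lower bound
  alone forces divergence, so that the limit of the quotient exists in either case.\<close>

lemma superadditive_gap_limit:
  fixes x y :: "nat \<Rightarrow> real"
  assumes x: "\<And>m n. x m + x n \<le> x (m + n)" "\<And>n. 0 \<le> x n"
    and y: "\<And>m n. y m + y n \<le> y (m + n)" "\<And>n. 0 \<le> y n"
    and gap: "\<And>n. y n + x (n div c) \<le> x n"
    and c: "0 < c" and pos: "0 < x 1"
  obtains (finite) l where "(\<lambda>n. (x n - y n) / real n) \<longlonglongrightarrow> l" "0 < l"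
    | (infinite) "LIM n sequentially. (x n - y n) / real n :> at_top"
proof (cases "\<exists>C. \<forall>n>0. x n / real n \<le> C")
  case True
  then obtain C where C: "\<And>n. 0 < n \<Longrightarrow> x n / real n \<le> C" by blast
  have "y n / real n \<le> C" if "0 < n" for n
    using C[OF that] gap[of n] x(2)[of "n div c"]
    by (meson add_increasing2 divide_right_mono of_nat_0_le_iff order_trans le_add_same_cancel1)
  then obtain Y where Y: "(\<lambda>n. y n / real n) \<longlonglongrightarrow> Y"
    using fekete[of y, OF y] by blast
  obtain X where X: "(\<lambda>n. x n / real n) \<longlonglongrightarrow> X" "\<And>n. 0 < n \<Longrightarrow> x n / real n \<le> X"
    using fekete[of x, OF x C] by blast
  have "(\<lambda>n. x n / real n - y n / real n) \<longlonglongrightarrow> X - Y"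
    by (intro tendsto_diff X Y)
  then have lim: "(\<lambda>n. (x n - y n) / real n) \<longlonglongrightarrow> X - Y"
    by (simp add: diff_divide_distrib)
  \<comment> \<open>Along the multiples \<open>c * q\<close> the index \<open>n div c\<close> is
    exactly \<open>q\<close>, so \<open>gap\<close> passes to the limit as
    \<open>X / c \<le> X - Y\<close>.\<close>
  have mono: "strict_mono (\<lambda>q. c * q)"
    using c by (simp add: strict_mono_def)
  have "X / real c \<le> X - Y"
  proof (rule LIMSEQ_le)
    show "(\<lambda>q. x q / real q / real c) \<longlonglongrightarrow> X / real c"
      by (intro tendsto_divide tendsto_const X) (use c in simp)
    show "(\<lambda>q. (x (c * q) - y (c * q)) / real (c * q)) \<longlonglongrightarrow> X - Y"
      using LIMSEQ_subseq_LIMSEQ[OF lim mono] by (simp add: o_def)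
    have "x q / real q / real c \<le> (x (c * q) - y (c * q)) / real (c * q)" for q
    proof -
      have "x q / real (c * q) \<le> (x (c * q) - y (c * q)) / real (c * q)"
        using gap[of "c * q"] c by (intro divide_right_mono) auto
      then show ?thesis by (simp add: mult.commute)
    qed
    then show "\<exists>N. \<forall>q\<ge>N. x q / real q / real c \<le> (x (c * q) - y (c * q)) / real (c * q)"
      by blast
  qed
  moreover have "0 < X / real c"
    using X(2)[of 1] pos c by simp
  ultimately show ?thesis
    using finite[OF lim] by linarith
next
  case False
  have "LIM n sequentially. (x n - y n) / real n :> at_top"
    unfolding filterlim_at_top_dense
  proof
    fix Z :: real
    \<comment> \<open>For \<open>q = n div c \<ge> 1\<close> one has
      \<open>n \<le> 2 * c * q\<close>, so a slope above \<open>W\<close> at \<open>q\<close> yields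
      a slope above \<open>\<bar>Z\<bar>\<close> at \<open>n\<close>; the summand 1 makes the
      inequality strict.\<close>
    define W where "W = 2 * real c * \<bar>Z\<bar> + 1"
    obtain m where "0 < m" "W < x m / real m"
      using False by (meson not_le)
    then have "eventually (\<lambda>n. W < x n / real n) sequentially"
      by (rule superadditive_eventually_gt[of x, OF x])
    then have "eventually (\<lambda>n. W < x (n div c) / real (n div c)) sequentially"
      by (rule eventually_compose_filterlim)
        (use c filterlim_at_top_div_const_nat in blast)
    then show "eventually (\<lambda>n. Z < (x n - y n) / real n) sequentially"
      using eventually_ge_at_top[of c]
    proof eventually_elim
      case (elim n)
      define q where "q = n div c"
      have q: "1 \<le> q" using elim c by (simp add: q_def div_greater_zero_iff Suc_le_eq)
      have n: "0 < n" using elim c by linarith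
      have "n = c * q + n mod c" "n mod c < c"
        using c by (simp_all add: q_def)
      then have "n \<le> c * (2 * q)"
        using mult_le_mono2[OF q, of c] by linarith
      then have "real n \<le> 2 * real c * real q"
        by (metis of_nat_le_iff of_nat_mult of_nat_numeral mult.assoc mult.left_commute)
      then have "real n * \<bar>Z\<bar> \<le> 2 * real c * real q * \<bar>Z\<bar>"
        by (rule mult_right_mono) simp
      also have "\<dots> < W * real q"
        using q by (simp add: W_def algebra_simps)
      also have "\<dots> < x q"
        using elim(1) q unfolding q_def[symmetric] by (simp add: field_simps)
      also have "\<dots> \<le> x n - y n"
        using gap[of n] unfolding q_def by linarith
      finally have "\<bar>Z\<bar> < (x n - y n) / real n"
        using n by (simp add: field_simps)
      then show ?case by linarith
    qed
  qed
  then show ?thesis by (rule infinite)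
qed

section \<open>Logarithms of diagonal Ramsey numbers and the limit\<close>

text \<open>The product inequalities concern the Ramsey number minus one; passing back costs at most
  a factor 2, which vanishes under \<open>r\<close>-th roots.\<close>

lemma ln_ramsey_diag_pred_bounds:
  assumes "2 \<le> k"
  shows "ln (real (ramsey_diag r k - 1)) \<le> ln (real (ramsey_diag r k))"
    and "ln (real (ramsey_diag r k)) \<le> ln (real (ramsey_diag r k - 1)) + ln 2"
proof -
  have ge: "2 \<le> ramsey_diag r k" using ramsey_diag_ge_2[OF assms] .
  then show "ln (real (ramsey_diag r k - 1)) \<le> ln (real (ramsey_diag r k))" by simp
  have "ln (real (ramsey_diag r k)) \<le> ln (real (ramsey_diag r k - 1) * 2)"
    using ge by (subst ln_le_cancel_iff) auto
  also have "\<dots> = ln (real (ramsey_diag r k - 1)) + ln 2"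
    using ge by (subst ln_mult) auto
  finally show "ln (real (ramsey_diag r k)) \<le> ln (real (ramsey_diag r k - 1)) + ln 2" .
qed

lemma ln_of_nat_mult_le:
  fixes a b c :: nat
  assumes "0 < a" "0 < b" "a * b \<le> c"
  shows "ln (real a) + ln (real b) \<le> ln (real c)"
proof -
  have "0 < real a * real b"
    using assms by simp
  moreover have "real a * real b \<le> real c"
    using assms(3) by (metis of_nat_le_iff of_nat_mult)
  ultimately have "ln (real a * real b) \<le> ln (real c)"
    by (subst ln_le_cancel_iff) auto
  then show ?thesis
    using assms by (simp add: ln_mult)
qed

lemma superadditive_ln_ramsey_diag_pred:
  assumes "2 \<le> k"
  shows "ln (real (ramsey_diag r k - 1)) + ln (real (ramsey_diag s k - 1))
           \<le> ln (real (ramsey_diag (r + s) k - 1))"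
  using ramsey_diag_ge_2[OF assms, of r] ramsey_diag_ge_2[OF assms, of s]
  by (intro ln_of_nat_mult_le ramsey_diag_supermult assms) auto

theorem theorem3:
  fixes k :: nat
  assumes "diagonal_conjecture"
    and "3 \<le> k"
  shows "\<exists>L::ereal.
           ((\<lambda>r. ereal (real (ramsey_diag r k) powr (1 / real r) /
                         real (ramsey_diag r (k - 1)) powr (1 / real r))) \<longlongrightarrow> L) sequentially
           \<and> L > 1"
proof -
  define x where "x = (\<lambda>r. ln (real (ramsey_diag r k - 1)))"
  define y where "y = (\<lambda>r. ln (real (ramsey_diag r (k - 1) - 1)))"
  \<comment> \<open>The error of replacing both Ramsey numbers by their predecessors: a difference
    of two corrections lying between \<open>0\<close> and \<open>ln 2\<close>.\<close>
  define e where "e = (\<lambda>r. ln (real (ramsey_diag r k)) - x r - (ln (real (ramsey_diag r (k - 1))) - y r))"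
  have k2: "2 \<le> k" "2 \<le> k - 1" using assms(2) by auto
  have ge: "2 \<le> ramsey_diag r k" "2 \<le> ramsey_diag r (k - 1)" for r
    using k2 ramsey_diag_ge_2 by auto
  have ratio: "real (ramsey_diag r k) powr (1 / real r) / real (ramsey_diag r (k - 1)) powr (1 / real r)
      = exp ((x r - y r) / real r + e r / real r)" for r
  proof -
    have "(x r - y r) / real r + e r / real r
        = ln (real (ramsey_diag r k)) / real r - ln (real (ramsey_diag r (k - 1))) / real r"
      by (simp add: e_def add_divide_distrib diff_divide_distrib)
    then show ?thesis
      using ge[of r] by (simp add: powr_def exp_diff)
  qed
  have "\<bar>e r\<bar> \<le> ln 2" for r
    using ln_ramsey_diag_pred_bounds[OF k2(1), of r] ln_ramsey_diag_pred_bounds[OF k2(2), of r]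
    unfolding e_def x_def y_def by linarith
  then have "\<bar>e r / real r\<bar> \<le> ln 2 / real r" for r
    by (simp add: divide_right_mono)
  then have "(\<lambda>r. \<bar>e r / real r\<bar>) \<longlonglongrightarrow> 0"
    by (intro tendsto_sandwich[OF _ _ tendsto_const lim_const_over_n[of "ln 2"]] always_eventually)
      auto
  then have e0: "(\<lambda>r. e r / real r) \<longlonglongrightarrow> 0"
    by (rule tendsto_rabs_zero_cancel)
  have gap: "y r + x (r div (k - 2)\<^sup>2) \<le> x r" for r
    unfolding x_def y_def using ge(2)[of r] ge(1)[of "r div (k - 2)\<^sup>2"]
    by (intro ln_of_nat_mult_le ramsey_diag_pred_mult_le assms) auto
  have nn: "0 \<le> x r" "0 \<le> y r" for r
    using ge[of r] by (auto simp: x_def y_def)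
  \<comment> \<open>With one colour the Ramsey number is at least \<open>k\<close>, so
    \<open>x 1\<close> is at least \<open>ln 2\<close>.\<close>
  have x1: "0 < x 1"
    using ramsey_diag_1[of k] assms(2) by (simp add: x_def)
  have c: "0 < (k - 2)\<^sup>2"
    using assms(2) by simp
  have sup: "x r + x s \<le> x (r + s)" "y r + y s \<le> y (r + s)" for r s
    unfolding x_def y_def by (intro superadditive_ln_ramsey_diag_pred k2)+
  show ?thesis
  proof (rule superadditive_gap_limit[of x y "(k - 2)\<^sup>2",
        OF sup(1) nn(1) sup(2) nn(2) gap c x1])
    fix l assume finite: "(\<lambda>r. (x r - y r) / real r) \<longlonglongrightarrow> l" "0 < l"
    have "(\<lambda>r. exp ((x r - y r) / real r + e r / real r)) \<longlonglongrightarrow> exp (l + 0)"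
      by (intro tendsto_exp tendsto_add finite e0)
    then show ?thesis
      unfolding ratio using finite(2)
      by (intro exI[of _ "ereal (exp l)"]) (simp add: one_ereal_def del: ereal_eq_1)
  next
    assume infinite: "LIM r sequentially. (x r - y r) / real r :> at_top"
    \<comment> \<open>A convergent error does not disturb the divergence, so the extended limit is
      infinite.\<close>
    have "LIM r sequentially. e r / real r + (x r - y r) / real r :> at_top"
      by (rule filterlim_tendsto_add_at_top[OF e0 infinite])
    then have "LIM r sequentially. exp ((x r - y r) / real r + e r / real r) :> at_top"
      by (intro filterlim_compose[OF exp_at_top]) (simp add: add.commute)
    then show ?thesis
      unfolding ratio by (intro exI[of _ \<infinity>]) (simp add: tendsto_PInfty_eq_at_top)
  qed
qed

end
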